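(* Let $\lambda\ge0$, $f(\alpha)=e^{-\lambda\alpha}$, and let $n\ge1$ be an integer. Let $S_k$ be the sample produced at time $t_k$ by the R-TBS algorithm for exponential decay with decay rate $\lambda$ and maximum sample size $n$, and let $C_k$ be the sample weight of the latent sample $L_k$ from which $S_k$ is generated. Let $H$ be any sampling algorithm for exponential decay, producing at each time $t_k$ a random sample $S^H_k\subseteq\mathcal{U}_k=\bigcup_{i=1}^k\mathcal{B}_i$, that satisfies $$\Pr[x\in S^H_k]/\Pr[y\in S^H_k]=f(\alpha_{i,k})/f(\alpha_{j,k})$$ for all $i\le j\le k$, $x\in\mathcal{B}_i$ and $y\in\mathcal{B}_j$, and that has maximal expected sample size $C_k$, i.e., $\mathbb{E}[|S^H_k|]=C_k$ for all $k\ge1$. Then $\operatorname{Var}[|S^H_k|]\ge\operatorname{Var}[|S_k|]$ for any $k\ge1$.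
   Context: Setting. $\mathcal{B}_1,\mathcal{B}_2,\ldots$ is a given sequence of pairwise disjoint finite sets of items (possibly empty); batch $\mathcal{B}_k$ arrives at time $t_k=k\Delta$, $\Delta>0$ fixed, and $t_0=0$. For $i\le k$, $\alpha_{i,k}=t_k-t_i$ is the age at time $t_k$ of items of $\mathcal{B}_i$. Write $\operatorname{frac}(x)=x-\lfloor x\rfloor$. Convention: $n/0=\infty$. Latent samples. A latent sample of a set $U$ with sample weight $C\ge0$ is a triple $L=(A,\pi,C)$ with $A\subseteq U$ a set of $\lfloor C\rfloor$ "full" items and $\pi\subseteq U$ (disjoint from $A$) a set with at most one "partial" item, nonempty iff $C>\lfloor C\rfloor$. GETSAMPLE$(A,\pi,C)$: draw $U$ uniform on $[0,1]$; return $A\cup\pi$ if $U\le\operatorname{frac}(C)$, else return $A$. Below, SAMPLE$(A,m)$ is a uniform random subset of $A$ of size $\min(m,|A|)$. SWAP1$(A,\pi)$: draw $I=$ SAMPLE$(A,1)$ and return $((A\setminus I)\cup\pi,\ I)$. MOVE1$(A,\pi)$: draw $I=$ SAMPLE$(A,1)$ and return $(A\setminus I,\ I)$. DOWNSAMPLE$((A,\pi,C),\theta)$ for $\theta\in(0,1)$: set $C'=\theta C$, draw $U$ uniform on $[0,1]$, start with $(A',\pi')=(A,\pi)$. - If $\lfloor C'\rfloor=0$: if $U>\operatorname{frac}(C)/C$ set $(A',\pi')=$ SWAP1$(A,\pi)$; then set $A'=\emptyset$. - Else if $\lfloor C'\rfloor=\lfloor C\rfloor$: if $U>(1-\theta\operatorname{frac}(C))/(1-\operatorname{frac}(C'))$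 set $(A',\pi')=$ SWAP1$(A,\pi)$. - Else ($0<\lfloor C'\rfloor<\lfloor C\rfloor$): if $U\le\theta\operatorname{frac}(C)$ set $A'=$ SAMPLE$(A,\lfloor C'\rfloor)$ and then $(A',\pi')=$ SWAP1$(A',\pi)$; otherwise set $A'=$ SAMPLE$(A,\lfloor C'\rfloor+1)$ and then $(A',\pi')=$ MOVE1$(A',\pi)$. Finally, if $C'$ is an integer set $\pi'=\emptyset$. Return $(A',\pi',C')$. For $\theta=1$ the input is returned unchanged, and the empty latent sample $(\emptyset,\emptyset,0)$ is always returned unchanged. UNION$((A_1,\pi_1,C_1),(A_2,\pi_2,C_2))$ for disjoint latent samples: set $C=C_1+C_2$, $a=\operatorname{frac}(C_1)$, $b=\operatorname{frac}(C_2)$, draw $U$ uniform on $[0,1]$. - If $a+b<1$: $A=A_1\cup A_2$; $\pi=\pi_1$ if $U\le a/(a+b)$, else $\pi=\pi_2$ (if $a=b=0$, $\pi=\emptyset$). - If $a+b=1$: $\pi=\emptyset$; $A=A_1\cup A_2\cup\pi_1$ if $U\le a$, else $A=A_1\cup A_2\cup\pi_2$. - If $a+b>1$: if $U\le(1-a)/[(1-a)+(1-b)]$ then $\pi=\pi_1$, $A=A_1\cup A_2\cup\pi_2$; else $\pi=\pi_2$, $A=A_1\cup A_2\cup\pi_1$. Return $(A,\pi,C)$. R-TBS for exponential decay (decay rate $\lambda\ge0$, maximum sample size $n$). Initialize $W=0$, latent sample $L=(\emptyset,\emptyset,0)$, $\rho=1$. For $k=1,2,\ldots$: set $\theta=e^{-\lambda(t_k-t_{k-1})}$;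 $W\leftarrow\theta W+|\mathcal{B}_k|$; $\rho'\leftarrow\rho$; $\rho\leftarrow\min(1,n/W)$; if the weight of $L$ is positive, $L\leftarrow$ DOWNSAMPLE$(L,(\rho/\rho')\theta)$; $L_0\leftarrow$ DOWNSAMPLE$((\mathcal{B}_k,\emptyset,|\mathcal{B}_k|),\rho)$; $L\leftarrow$ UNION$(L_0,L)$; denote this latent sample by $L_k=(A_k,\pi_k,C_k)$; output $S_k=$ GETSAMPLE$(L_k)$. All random draws are mutually independent. *)

theory Defs
  imports "HOL-Probability.Probability"
begin

text \<open>The outcome of the comparison \<open>U \<le> p\<close> for a fresh \<open>U\<close> uniform on \<open>[0,1]\<close>. Every uniform
  variable drawn by the algorithms below is used in exactly one such comparison, and successive
  binds in the pmf monad are independent draws.\<close>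

definition unif_le :: "real \<Rightarrow> bool pmf" where
  "unif_le p = bernoulli_pmf (measure (uniform_measure lborel {0..1::real}) {..p})"

text \<open>A latent sample \<open>(A, \<pi>, C)\<close>: full items, partial item (a set with at most one element),
  sample weight.\<close>

type_synonym 'a latent = "'a set \<times> 'a set \<times> real"

definition sample_weight :: "'a latent \<Rightarrow> real" where
  "sample_weight = (\<lambda>(A, \<pi>, C). C)"

definition empty_latent :: "'a latent" where
  "empty_latent = ({}, {}, 0)"

definition getsample :: "'a latent \<Rightarrow> 'a set pmf" where
  "getsample = (\<lambda>(A, \<pi>, C). do {
     u \<leftarrow> unif_le (frac C);
     return_pmf (if u then A \<union> \<pi> else A)
   })"

definition sample :: "'a set \<Rightarrow> nat \<Rightarrow> 'a set pmf" where
  "sample A m = pmf_of_set {S. S \<subseteq> A \<and> card S = min m (card A)}"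

definition swap1 :: "'a set \<Rightarrow> 'a set \<Rightarrow> ('a set \<times> 'a set) pmf" where
  "swap1 A \<pi> = do { I \<leftarrow> sample A 1; return_pmf ((A - I) \<union> \<pi>, I) }"

definition move1 :: "'a set \<Rightarrow> 'a set \<Rightarrow> ('a set \<times> 'a set) pmf" where
  "move1 A \<pi> = do { I \<leftarrow> sample A 1; return_pmf (A - I, I) }"

definition downsample :: "'a latent \<Rightarrow> real \<Rightarrow> 'a latent pmf" where
  "downsample = (\<lambda>(A, \<pi>, C) \<theta>.
     if \<theta> = 1 \<or> (A, \<pi>, C) = empty_latent then return_pmf (A, \<pi>, C)
     else let C' = \<theta> * C in do {
       (A', \<pi>') \<leftarrow>
         (if \<lfloor>C'\<rfloor> = 0 then do {
            u \<leftarrow> unif_le (frac C / C);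
            (A1, \<pi>1) \<leftarrow> (if u then return_pmf (A, \<pi>) else swap1 A \<pi>);
            return_pmf ({}, \<pi>1)
          }
          else if \<lfloor>C'\<rfloor> = \<lfloor>C\<rfloor> then do {
            u \<leftarrow> unif_le ((1 - \<theta> * frac C) / (1 - frac C'));
            (if u then return_pmf (A, \<pi>) else swap1 A \<pi>)
          }
          else do {
            u \<leftarrow> unif_le (\<theta> * frac C);
            (if u then do { A1 \<leftarrow> sample A (nat \<lfloor>C'\<rfloor>); swap1 A1 \<pi> }
             else do { A1 \<leftarrow> sample A (nat \<lfloor>C'\<rfloor> + 1); move1 A1 \<pi> })
          });
       return_pmf (A', (if C' \<in> \<int> then {} else \<pi>'), C')
     })"

definition union_latent :: "'a latent \<Rightarrow> 'a latent \<Rightarrow> 'a latent pmf" where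
  "union_latent = (\<lambda>(A1, \<pi>1, C1) (A2, \<pi>2, C2).
     let C = C1 + C2; a = frac C1; b = frac C2 in
       if a + b < 1 then do {
         u \<leftarrow> unif_le (a / (a + b));
         return_pmf (A1 \<union> A2, (if a = 0 \<and> b = 0 then {} else if u then \<pi>1 else \<pi>2), C)
       }
       else if a + b = 1 then do {
         u \<leftarrow> unif_le a;
         return_pmf (A1 \<union> A2 \<union> (if u then \<pi>1 else \<pi>2), {}, C)
       }
       else do {
         u \<leftarrow> unif_le ((1 - a) / ((1 - a) + (1 - b)));
         return_pmf (if u then (A1 \<union> A2 \<union> \<pi>2, \<pi>1, C) else (A1 \<union> A2 \<union> \<pi>1, \<pi>2, C))
       })"

definition arrival_time :: "real \<Rightarrow> nat \<Rightarrow> real" where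
  "arrival_time \<Delta> k = real k * \<Delta>"

definition age :: "real \<Rightarrow> nat \<Rightarrow> nat \<Rightarrow> real" where
  "age \<Delta> i k = arrival_time \<Delta> k - arrival_time \<Delta> i"

definition exp_decay :: "real \<Rightarrow> real \<Rightarrow> real" where
  "exp_decay lam \<alpha> = exp (- lam * \<alpha>)"

definition decay_step :: "real \<Rightarrow> real \<Rightarrow> nat \<Rightarrow> real" where
  "decay_step \<Delta> lam k = exp (- lam * (arrival_time \<Delta> k - arrival_time \<Delta> (k - 1)))"

text \<open>The values of \<open>W\<close>, \<open>\<rho>\<close> and \<open>L\<close> after processing batch \<open>k\<close> (after the initialization, for
  \<open>k = 0\<close>); \<open>W\<close> and \<open>\<rho>\<close> are deterministic. Batches are indexed from 1, so \<open>B 0\<close> is never used.\<close>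

fun total_weight :: "real \<Rightarrow> real \<Rightarrow> (nat \<Rightarrow> 'a set) \<Rightarrow> nat \<Rightarrow> real" where
  "total_weight \<Delta> lam B 0 = 0"
| "total_weight \<Delta> lam B (Suc k) =
     decay_step \<Delta> lam (Suc k) * total_weight \<Delta> lam B k + real (card (B (Suc k)))"

text \<open>The case \<open>W = 0\<close> is separate because of the convention \<open>n / 0 = \<infinity>\<close>; it also covers the
  initialization \<open>\<rho> = 1\<close>.\<close>

definition accept_rate :: "real \<Rightarrow> real \<Rightarrow> nat \<Rightarrow> (nat \<Rightarrow> 'a set) \<Rightarrow> nat \<Rightarrow> real" where
  "accept_rate \<Delta> lam n B k =
     (let W = total_weight \<Delta> lam B k in if W = 0 then 1 else min 1 (real n / W))"

fun rtbs_latent :: "real \<Rightarrow> real \<Rightarrow> nat \<Rightarrow> (nat \<Rightarrow> 'a set) \<Rightarrow> nat \<Rightarrow> 'a latent pmf" where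
  "rtbs_latent \<Delta> lam n B 0 = return_pmf empty_latent"
| "rtbs_latent \<Delta> lam n B (Suc k) =
     (let \<theta> = decay_step \<Delta> lam (Suc k);
          \<rho>' = accept_rate \<Delta> lam n B k;
          \<rho> = accept_rate \<Delta> lam n B (Suc k)
      in do {
        L \<leftarrow> rtbs_latent \<Delta> lam n B k;
        L1 \<leftarrow> (if sample_weight L > 0 then downsample L ((\<rho> / \<rho>') * \<theta>) else return_pmf L);
        L0 \<leftarrow> downsample (B (Suc k), {}, real (card (B (Suc k)))) \<rho>;
        union_latent L0 L1
      })"

definition rtbs_sample :: "real \<Rightarrow> real \<Rightarrow> nat \<Rightarrow> (nat \<Rightarrow> 'a set) \<Rightarrow> nat \<Rightarrow> 'a set pmf" where
  "rtbs_sample \<Delta> lam n B k = do { L \<leftarrow> rtbs_latent \<Delta> lam n B k; getsample L }"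

text \<open>The sample weight of \<open>L\<^sub>k\<close> is deterministic, so that it is meaningful to speak of the number
  \<open>C\<^sub>k\<close>.\<close>

lemma sample_weight_downsample:
  "L' \<in> set_pmf (downsample L \<theta>) \<Longrightarrow> sample_weight L' = \<theta> * sample_weight L"
  by (cases L)
     (auto simp: downsample_def sample_weight_def empty_latent_def Let_def split: if_splits)

lemma sample_weight_union_latent:
  "L \<in> set_pmf (union_latent L1 L2) \<Longrightarrow> sample_weight L = sample_weight L1 + sample_weight L2"
  by (cases L1; cases L2)
     (auto simp: union_latent_def sample_weight_def Let_def split: if_splits)

lemma sample_weight_rtbs_latent_unique:
  "\<lbrakk>L \<in> set_pmf (rtbs_latent \<Delta> lam n B k); L' \<in> set_pmf (rtbs_latent \<Delta> lam n B k)\<rbrakk>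
    \<Longrightarrow> sample_weight L = sample_weight L'"
proof (induction k arbitrary: L L')
  case 0
  then show ?case by simp
next
  case (Suc k)
  define c where "c = accept_rate \<Delta> lam n B (Suc k) / accept_rate \<Delta> lam n B k
    * decay_step \<Delta> lam (Suc k)"
  define d where "d = accept_rate \<Delta> lam n B (Suc k) * real (card (B (Suc k)))"
  have *: "\<exists>M \<in> set_pmf (rtbs_latent \<Delta> lam n B k). sample_weight K =
      d + (if sample_weight M > 0 then c * sample_weight M else sample_weight M)"
    if "K \<in> set_pmf (rtbs_latent \<Delta> lam n B (Suc k))" for K
  proof -
    from that obtain L0 L1 M where
      "M \<in> set_pmf (rtbs_latent \<Delta> lam n B k)"
      and "L1 \<in> set_pmf (if sample_weight M > 0 then downsample M (accept_rate \<Delta> lam n B (Suc k)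
             / accept_rate \<Delta> lam n B k * decay_step \<Delta> lam (Suc k)) else return_pmf M)"
      and "L0 \<in> set_pmf (downsample (B (Suc k), {}, real (card (B (Suc k))))
             (accept_rate \<Delta> lam n B (Suc k)))"
      and "K \<in> set_pmf (union_latent L0 L1)"
      by (auto simp: Let_def)
    moreover have "sample_weight (B (Suc k), {}, real (card (B (Suc k)))) = real (card (B (Suc k)))"
      by (simp add: sample_weight_def)
    ultimately show ?thesis
      by (intro bexI[of _ M])
         (auto simp: c_def d_def
           dest!: sample_weight_downsample sample_weight_union_latent split: if_splits)
  qed
  show ?case
    using *[OF Suc.prems(1)] *[OF Suc.prems(2)] Suc.IH by metis
qed

end

theory Submission imports Defs
begin

text \<open>Every latent sample that R-TBS can produce has exactly \<open>\<lfloor>C\<rfloor>\<close> full items, and a partial item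
  unless \<open>C\<close> is an integer. Hence \<open>|S\<^sub>k|\<close> is \<open>\<lfloor>C\<^sub>k\<rfloor>\<close> plus a Bernoulli variable with parameter
  \<open>frac C\<^sub>k\<close>, with variance \<open>f (1 - f)\<close> for \<open>f = frac C\<^sub>k\<close>. An integer-valued \<open>X\<close> with mean \<open>C\<close>
  cannot do better, since \<open>(X - \<lfloor>C\<rfloor>) (X - \<lfloor>C\<rfloor> - 1) \<ge> 0\<close>.\<close>

section \<open>Supports of the elementary random draws\<close>

text \<open>Under the uniform measure \<open>{..p}\<close> has the mass of
  \<open>{0..min 1 p}\<close>. The clamp makes this hold for every real threshold, so later uses
  need no range check.\<close>

lemma unif_le_eq_bernoulli:
  "unif_le p = bernoulli_pmf (max 0 (min 1 p))"
proof -
  have "{0..1} \<inter> {..p} = {0..min 1 p}"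
    by auto
  then have "measure (uniform_measure lborel {0..1::real}) {..p} = max 0 (min 1 p)"
    by (simp add: measure_def emeasure_uniform_measure emeasure_lborel_Icc_eq divide_ennreal_def
        max_def min_def)
  then show ?thesis
    by (simp add: unif_le_def)
qed

text \<open>The shape of a latent sample depends only on which branches are possible, so supports
  suffice. The strict inequalities rule out branches that would call for a missing partial or full
  item.\<close>

lemma set_pmf_unif_le: "u \<in> set_pmf (unif_le p) \<longleftrightarrow> (if u then p > 0 else p < 1)"
proof -
  have "pmf (unif_le p) u = (if u then max 0 (min 1 p) else 1 - max 0 (min 1 p))"
    by (cases u) (simp_all add: unif_le_eq_bernoulli)
  then show ?thesis
    unfolding set_pmf_iff by (simp; linarith)
qed

lemma set_pmf_sample:
  assumes "finite A"
  shows "set_pmf (sample A m) = {S. S \<subseteq> A \<and> card S = min m (card A)}"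
proof -
  \<comment> \<open>\<open>pmf_of_set\<close> has the intended meaning only on a finite nonempty
    set, so a subset of the required size is exhibited.\<close>
  obtain T where "T \<subseteq> A" "card T = min m (card A)"
    by (meson min.cobounded2 obtain_subset_with_card_n)
  then have "{S. S \<subseteq> A \<and> card S = min m (card A)} \<noteq> {}"
    by blast
  moreover have "finite {S. S \<subseteq> A \<and> card S = min m (card A)}"
    using assms by simp
  ultimately show ?thesis
    unfolding sample_def by (rule set_pmf_of_set)
qed

lemma set_pmf_sample_one:
  assumes "finite A" "A \<noteq> {}"
  shows "set_pmf (sample A 1) = (\<lambda>x. {x}) ` A"
proof -
  have "min 1 (card A) = 1"
    using assms by (simp add: Suc_leI card_gt_0_iff)
  then have "set_pmf (sample A 1) = {S. S \<subseteq> A \<and> card S = 1}"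
    using set_pmf_sample[OF assms(1), of 1] by (simp only:)
  also have "\<dots> = (\<lambda>x. {x}) ` A"
    unfolding One_nat_def card_1_singleton_iff by auto
  finally show ?thesis .
qed

lemma set_pmf_swap1:
  assumes "finite A" "A \<noteq> {}"
  shows "set_pmf (swap1 A \<pi>) = (\<lambda>x. (A - {x} \<union> \<pi>, {x})) ` A"
  unfolding swap1_def using set_pmf_sample_one[OF assms] by auto

lemma set_pmf_move1:
  assumes "finite A" "A \<noteq> {}"
  shows "set_pmf (move1 A \<pi>) = (\<lambda>x. (A - {x}, {x})) ` A"
  unfolding move1_def using set_pmf_sample_one[OF assms] by auto

section \<open>The shape invariant and its preservation by downsampling and union\<close>

text \<open>Equating \<open>\<lfloor>C\<rfloor>\<close> with a cardinality in \<open>int\<close>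
  also forces \<open>C \<ge> 0\<close>. Finiteness is explicit because \<open>card\<close> of an
  infinite set is 0. The carrier \<open>U\<close> is tracked so that disjointness is available when
  latent samples are united.\<close>

definition valid_latent :: "'a set \<Rightarrow> 'a latent \<Rightarrow> bool" where
  "valid_latent U = (\<lambda>(A, \<pi>, C). finite A \<and> finite \<pi> \<and> A \<subseteq> U \<and> \<pi> \<subseteq> U \<and> A \<inter> \<pi> = {}
     \<and> int (card A) = \<lfloor>C\<rfloor> \<and> card \<pi> = of_bool (C \<notin> \<int>))"

lemma valid_latent_empty: "valid_latent U empty_latent"
  by (simp add: valid_latent_def empty_latent_def)

lemma valid_latent_full: "finite A \<Longrightarrow> valid_latent A (A, {}, real (card A))"
  by (simp add: valid_latent_def)

text \<open>A non-integer weight supplies a partial item and \<open>C \<ge> 1\<close> a full one, so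
  the swap is a genuine exchange that keeps both cardinalities.\<close>

lemma valid_latent_swap1:
  assumes "valid_latent U (A, \<pi>, C)" "C \<notin> \<int>" "C \<ge> 1" "(A', \<pi>') \<in> set_pmf (swap1 A \<pi>)"
  shows "valid_latent U (A', \<pi>', C)"
proof -
  have fin: "finite A" "finite \<pi>" and c: "card \<pi> = 1" "int (card A) = \<lfloor>C\<rfloor>"
    and sub: "A \<subseteq> U" "\<pi> \<subseteq> U" "A \<inter> \<pi> = {}"
    using assms by (auto simp: valid_latent_def)
  have "card A \<ge> 1"
    using c \<open>C \<ge> 1\<close> by linarith
  then have "A \<noteq> {}"
    by auto
  then obtain x where x: "x \<in> A" "A' = A - {x} \<union> \<pi>" "\<pi>' = {x}"
    using assms(4) fin by (auto simp: set_pmf_swap1)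
  have "card A' = card (A - {x}) + card \<pi>"
    unfolding x(2) using fin sub by (intro card_Un_disjoint) auto
  then have "card A' = card A"
    using x fin c \<open>card A \<ge> 1\<close> by simp
  then show ?thesis
    using x fin sub c \<open>C \<notin> \<int>\<close> by (auto simp: valid_latent_def)
qed

text \<open>In each branch one checks that a possible outcome has
  \<open>\<lfloor>C'\<rfloor>\<close> full items and one partial item. The last step of the
  algorithm then drops the partial item if \<open>C'\<close> is an integer.\<close>

lemma valid_latent_downsample:
  assumes val: "valid_latent U L" and \<theta>: "0 < \<theta>" "\<theta> \<le> 1"
    and L': "L' \<in> set_pmf (downsample L \<theta>)"
  shows "valid_latent U L'"
proof -
  obtain A \<pi> C where L: "L = (A, \<pi>, C)"
    by (cases L)
  have fin: "finite A" "finite \<pi>" and cA: "int (card A) = \<lfloor>C\<rfloor>"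
    and c\<pi>: "card \<pi> = of_bool (C \<notin> \<int>)"
    and sub: "A \<subseteq> U" "\<pi> \<subseteq> U" "A \<inter> \<pi> = {}"
    using val by (auto simp: valid_latent_def L)
  show ?thesis
  proof (cases "\<theta> = 1 \<or> L = empty_latent")
    case True
    then show ?thesis
      using L' val by (auto simp: downsample_def L)
  next
    case False
    \<comment> \<open>A valid latent sample of weight 0 is \<open>empty_latent\<close>, which is
      excluded here.\<close>
    have "C \<noteq> 0"
      using False fin cA c\<pi> by (auto simp: L empty_latent_def)
    moreover have "0 \<le> \<lfloor>C\<rfloor>"
      using cA by linarith
    ultimately have C: "C > 0"
      by linarith
    define C' where "C' = \<theta> * C"
    have C': "0 < C'" "C' < C"
      using \<theta> False C by (auto simp: C'_def)
    have ne: "A \<noteq> {}" if "C \<ge> 1"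
    proof -
      have "card A \<ge> 1"
        using that cA by linarith
      then show ?thesis
        by auto
    qed
    consider (zero) "\<lfloor>C'\<rfloor> = 0" | (same) "\<lfloor>C'\<rfloor> \<noteq> 0" "\<lfloor>C'\<rfloor> = \<lfloor>C\<rfloor>"
      | (less) "\<lfloor>C'\<rfloor> \<noteq> 0" "\<lfloor>C'\<rfloor> \<noteq> \<lfloor>C\<rfloor>"
      by blast
    then show ?thesis
    proof cases
      case zero
      then obtain u A1 \<pi>1 where u: "u \<in> set_pmf (unif_le (frac C / C))"
        and 1: "(A1, \<pi>1) \<in> set_pmf (if u then return_pmf (A, \<pi>) else swap1 A \<pi>)"
        and L'_eq: "L' = ({}, (if C' \<in> \<int> then {} else \<pi>1), C')"
        using L' False by (auto simp: downsample_def L Let_def C'_def)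
      \<comment> \<open>Keeping \<open>\<pi>\<close> is possible only if \<open>frac C > 0\<close>,
        so \<open>\<pi>\<close> is nonempty. Swapping is possible only if \<open>frac C < C\<close>,
        so there is a full item to swap out.\<close>
      have "finite \<pi>1 \<and> \<pi>1 \<subseteq> U \<and> card \<pi>1 = 1"
      proof (cases u)
        case True
        then have "C \<notin> \<int>"
          using u C by (auto simp: set_pmf_unif_le zero_less_divide_iff)
        then show ?thesis
          using True 1 fin sub c\<pi> by auto
      next
        case False
        then have "frac C < C"
          using u C by (simp add: set_pmf_unif_le)
        then have "\<lfloor>C\<rfloor> > 0"
          by (simp add: frac_def)
        then have "C \<ge> 1"
          by linarith
        then show ?thesis
          using False 1 fin sub ne by (auto simp: set_pmf_swap1)
      qed
      then show ?thesis
        using zero C' by (auto simp: valid_latent_def L'_eq)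
    next
      case same
      then obtain u A1 \<pi>1 
        where 1: "(A1, \<pi>1) \<in> set_pmf (if u then return_pmf (A, \<pi>) else swap1 A \<pi>)"
        and L'_eq: "L' = (A1, (if C' \<in> \<int> then {} else \<pi>1), C')"
        using L' False by (auto simp: downsample_def L Let_def C'_def)
      have "C \<ge> 1"
        using same C C' by linarith
      \<comment> \<open>An integer \<open>C\<close> would equal \<open>\<lfloor>C'\<rfloor>\<close>,
        contradicting \<open>C' < C\<close>.\<close>
      have "C \<notin> \<int>"
        using same C' by (metis Ints_cases floor_of_int le_floor_iff linorder_not_le order_refl)
      then have "valid_latent U (A1, \<pi>1, C)"
        using 1 val \<open>C \<ge> 1\<close> valid_latent_swap1[of U A \<pi> C A1 \<pi>1] by (auto simp: L split: if_splits)
      then show ?thesis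
        using same \<open>C \<notin> \<int>\<close> by (auto simp: valid_latent_def L'_eq)
    next
      case less
      define m where "m = nat \<lfloor>C'\<rfloor>"
      \<comment> \<open>The bound \<open>m + 1 \<le> card A\<close> makes the \<open>min\<close> in
        \<open>sample\<close> inert: exactly \<open>m\<close> or \<open>m + 1\<close> items are
        drawn.\<close>
      have m: "int m = \<lfloor>C'\<rfloor>" "m \<ge> 1" "m + 1 \<le> card A"
        using less C' cA floor_mono[of C' C] unfolding m_def by linarith+
      from less L' False obtain u A1 \<pi>1 where u: "u \<in> set_pmf (unif_le (\<theta> * frac C))"
        and 1: "(A1, \<pi>1) \<in> set_pmf (if u then do { A1 \<leftarrow> sample A m; swap1 A1 \<pi> }
             else do { A1 \<leftarrow> sample A (m + 1); move1 A1 \<pi> })"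
        and L'_eq: "L' = (A1, (if C' \<in> \<int> then {} else \<pi>1), C')"
        unfolding m_def C'_def by (auto simp: downsample_def L Let_def)
      \<comment> \<open>Swapping returns the old partial item, which exists since
        \<open>\<theta> * frac C > 0\<close> in that branch, so \<open>m\<close> items stay full.
        Moving starts from \<open>m + 1\<close> items and gives one up.\<close>
      have "finite A1 \<and> A1 \<subseteq> U \<and> card A1 = m \<and> \<pi>1 \<subseteq> U \<and> card \<pi>1 = 1 \<and> A1 \<inter> \<pi>1 = {}"
      proof (cases u)
        case True
        then have "C \<notin> \<int>"
          using u \<theta> by (auto simp: set_pmf_unif_le zero_less_mult_iff)
        obtain S where S: "S \<subseteq> A" "card S = m" and 2: "(A1, \<pi>1) \<in> set_pmf (swap1 S \<pi>)"
          using 1 True fin m by (auto simp: set_pmf_sample)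
        have "finite S" "S \<noteq> {}"
          using S m fin finite_subset by auto
        then obtain x where x: "x \<in> S" "A1 = S - {x} \<union> \<pi>" "\<pi>1 = {x}"
          using 2 by (auto simp: set_pmf_swap1)
        have "card A1 = card (S - {x}) + card \<pi>"
          unfolding x(2) using fin S sub \<open>finite S\<close> by (intro card_Un_disjoint) auto
        then have "card A1 = m"
          using x S m \<open>finite S\<close> c\<pi> \<open>C \<notin> \<int>\<close> by simp
        then show ?thesis
          using x S sub fin \<open>finite S\<close> by auto
      next
        case False
        obtain S where S: "S \<subseteq> A" "card S = m + 1" and 2: "(A1, \<pi>1) \<in> set_pmf (move1 S \<pi>)"
          using 1 False fin m by (auto simp: set_pmf_sample min_def)
        have "finite S" "S \<noteq> {}"
          using S m fin finite_subset by auto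
        then obtain x where x: "x \<in> S" "A1 = S - {x}" "\<pi>1 = {x}"
          using 2 by (auto simp: set_pmf_move1)
        then show ?thesis
          using S sub \<open>finite S\<close> by auto
      qed
      then show ?thesis
        using m by (auto simp: valid_latent_def L'_eq intro: card_ge_0_finite)
    qed
  qed
qed

text \<open>The cases follow the carry when fractional parts are added. Without a carry at most one
  partial item survives. With a carry one of them becomes full, and the other stays partial unless
  the sum is an integer. Disjoint carriers make cardinalities additive.\<close>

lemma valid_latent_union_latent:
  assumes val: "valid_latent U1 L1" "valid_latent U2 L2" and disj: "U1 \<inter> U2 = {}"
    and L: "L \<in> set_pmf (union_latent L1 L2)"
  shows "valid_latent (U1 \<union> U2) L"
proof -
  obtain A1 \<pi>1 C1 A2 \<pi>2 C2 where L12: "L1 = (A1, \<pi>1, C1)" "L2 = (A2, \<pi>2, C2)"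
    by (cases L1, cases L2)
  define a b where "a = frac C1" and "b = frac C2"
  have ab: "0 \<le> a" "a < 1" "0 \<le> b" "b < 1"
    by (auto simp: a_def b_def frac_lt_1)
  have fin: "finite A1" "finite \<pi>1" "finite A2" "finite \<pi>2"
    and sub: "A1 \<subseteq> U1" "\<pi>1 \<subseteq> U1" "A1 \<inter> \<pi>1 = {}" "A2 \<subseteq> U2" "\<pi>2 \<subseteq> U2" "A2 \<inter> \<pi>2 = {}"
    and cA: "int (card A1) = \<lfloor>C1\<rfloor>" "int (card A2) = \<lfloor>C2\<rfloor>"
    and c\<pi>: "card \<pi>1 = of_bool (a \<noteq> 0)" "card \<pi>2 = of_bool (b \<noteq> 0)"
    using val by (auto simp: valid_latent_def L12 a_def b_def frac_eq_0_iff)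
  have dis: "A1 \<inter> A2 = {}" "A1 \<inter> \<pi>2 = {}" "A2 \<inter> \<pi>1 = {}" "\<pi>1 \<inter> \<pi>2 = {}" "\<pi>2 \<inter> \<pi>1 = {}"
    using sub disj by blast+
  note dis = dis sub(3,6)
  have card_Un: "card (A1 \<union> A2) = card A1 + card A2"
    "card (A1 \<union> A2 \<union> \<pi>1) = card A1 + card A2 + card \<pi>1"
    "card (A1 \<union> A2 \<union> \<pi>2) = card A1 + card A2 + card \<pi>2"
    using fin dis by (simp_all add: card_Un_disjoint Int_Un_distrib2)
  have int: "C1 + C2 \<in> \<int> \<longleftrightarrow> a + b \<in> {0, 1}"
  proof -
    have "C1 + C2 \<in> \<int> \<longleftrightarrow> frac (C1 + C2) = 0"
      by (simp add: frac_eq_0_iff)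
    then show ?thesis
      using ab by (auto simp: frac_add simp flip: a_def b_def)
  qed
  have fl: "\<lfloor>C1 + C2\<rfloor> = \<lfloor>C1\<rfloor> + \<lfloor>C2\<rfloor> + (if a + b < 1 then 0 else 1)"
    by (simp add: floor_add a_def b_def)
  consider (lt) "a + b < 1" | (eq) "a + b = 1" | (gt) "a + b > 1"
    by linarith
  then show ?thesis
  proof cases
    case lt
    obtain u where u: "u \<in> set_pmf (unif_le (a / (a + b)))"
      and L_eq: "L = (A1 \<union> A2, (if a = 0 \<and> b = 0 then {} else if u then \<pi>1 else \<pi>2), C1 + C2)"
      using L lt by (auto simp: union_latent_def L12 Let_def simp flip: a_def b_def)
    \<comment> \<open>If exactly one of \<open>a\<close> and \<open>b\<close> is 0, the threshold is
      0 or 1, so the empty partial set is never chosen.\<close>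
    have *: "if u then a \<noteq> 0 else b \<noteq> 0" if "\<not> (a = 0 \<and> b = 0)"
      using u ab that by (auto simp: set_pmf_unif_le zero_less_divide_iff divide_less_eq
          split: if_splits)
    show ?thesis
      using * fin sub(1,2,4,5) dis cA c\<pi> card_Un ab lt
      unfolding valid_latent_def L_eq by (auto simp: int fl Int_Un_distrib2)
  next
    case eq
    then have "a \<noteq> 0" "b \<noteq> 0"
      using ab by auto
    obtain u where "L = (A1 \<union> A2 \<union> (if u then \<pi>1 else \<pi>2), {}, C1 + C2)"
      using L eq by (auto simp: union_latent_def L12 Let_def simp flip: a_def b_def)
    then show ?thesis
      using fin sub(1,2,4,5) dis cA c\<pi> card_Un eq \<open>a \<noteq> 0\<close> \<open>b \<noteq> 0\<close>
      unfolding valid_latent_def by (cases u) (auto simp: int fl Int_Un_distrib2)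
  next
    case gt
    then have "a \<noteq> 0" "b \<noteq> 0"
      using ab by auto
    obtain u where "L = (if u then (A1 \<union> A2 \<union> \<pi>2, \<pi>1, C1 + C2) else (A1 \<union> A2 \<union> \<pi>1, \<pi>2, C1 + C2))"
      using L gt by (auto simp: union_latent_def L12 Let_def simp flip: a_def b_def)
    then show ?thesis
      using fin sub(1,2,4,5) dis cA c\<pi> card_Un gt \<open>a \<noteq> 0\<close> \<open>b \<noteq> 0\<close>
      unfolding valid_latent_def by (cases u) (auto simp: int fl Int_Un_distrib2)
  qed
qed

section \<open>Downsampling factors and the invariant along a run of R-TBS\<close>

lemma decay_step_bounds:
  assumes "\<Delta> > 0" "lam \<ge> 0"
  shows "0 < decay_step \<Delta> lam k" "decay_step \<Delta> lam k \<le> 1"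
  using assms by (auto simp: decay_step_def arrival_time_def mult_right_mono)

lemma total_weight_nonneg: "total_weight \<Delta> lam B k \<ge> 0"
  by (induction k) (auto simp: decay_step_def)

lemma accept_rate_bounds:
  assumes "n \<ge> 1"
  shows "0 < accept_rate \<Delta> lam n B k" "accept_rate \<Delta> lam n B k \<le> 1"
  using assms total_weight_nonneg[of \<Delta> lam B k] by (auto simp: accept_rate_def Let_def)

text \<open>The acceptance rate may grow from one step to the next, but only because the total weight
  shrinks, which it does at most by the decay factor.\<close>

lemma downsample_rate_le_1:
  assumes "\<Delta> > 0" "lam \<ge> 0" "n \<ge> 1"
  shows "accept_rate \<Delta> lam n B (Suc k) / accept_rate \<Delta> lam n B k * decay_step \<Delta> lam (Suc k) \<le> 1"
proof -
  define d W W' where "d = decay_step \<Delta> lam (Suc k)" and "W = total_weight \<Delta> lam B k"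
    and "W' = total_weight \<Delta> lam B (Suc k)"
  define r r' where "r = accept_rate \<Delta> lam n B k" and "r' = accept_rate \<Delta> lam n B (Suc k)"
  have d: "0 < d" "d \<le> 1"
    using decay_step_bounds[OF assms(1,2)] by (auto simp: d_def)
  have r: "0 < r" "0 < r'" "r' \<le> 1"
    using accept_rate_bounds[OF assms(3)] by (auto simp: r_def r'_def)
  have "r' * d \<le> r"
  proof (cases "r = 1")
    case True
    then show ?thesis
      using r d mult_mono[of r' 1 d 1] by simp
  next
    case False
    have W: "W > 0" "r = n / W"
      using False total_weight_nonneg[of \<Delta> lam B k]
      by (auto simp: r_def accept_rate_def W_def Let_def min_def split: if_splits)
    have "d * W \<le> W'"
      by (simp add: d_def W_def W'_def)
    moreover have "d * W > 0"
      using d W by simp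
    ultimately have W': "d * W \<le> W'" "W' > 0"
      by linarith+
    have "r' \<le> n / W'"
      using W' by (auto simp: r'_def accept_rate_def W'_def Let_def)
    also have "\<dots> \<le> n / (d * W)"
      using W' \<open>d * W > 0\<close> by (intro divide_left_mono) auto
    finally show ?thesis
      using d by (simp add: W(2) pos_le_divide_eq pos_divide_le_eq mult.commute flip: divide_divide_eq_left)
  qed
  then show ?thesis
    using r by (simp add: field_simps flip: d_def r_def r'_def)
qed

text \<open>By induction on \<open>k\<close>: both downsampling factors lie in
  \<open>(0, 1]\<close>, and the new batch is disjoint from all earlier ones, so each operation of a
  round preserves the invariant.\<close>

lemma valid_latent_rtbs_latent:
  assumes "\<Delta> > 0" "lam \<ge> 0" "n \<ge> 1"
    and fin: "\<And>k. k \<ge> 1 \<Longrightarrow> finite (B k)" and disj: "disjoint_family_on B {1..}"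
    and "L \<in> set_pmf (rtbs_latent \<Delta> lam n B k)"
  shows "valid_latent (\<Union>i\<in>{1..k}. B i) L"
  using \<open>L \<in> _\<close>
proof (induction k arbitrary: L)
  case 0
  then show ?case
    by (simp add: valid_latent_empty)
next
  case (Suc k)
  define \<rho> \<theta> where "\<rho> = accept_rate \<Delta> lam n B (Suc k)"
    and "\<theta> = \<rho> / accept_rate \<Delta> lam n B k * decay_step \<Delta> lam (Suc k)"
  obtain M L0 L1 where M: "M \<in> set_pmf (rtbs_latent \<Delta> lam n B k)"
    and L1: "L1 \<in> set_pmf (if sample_weight M > 0 then downsample M \<theta> else return_pmf M)"
    and L0: "L0 \<in> set_pmf (downsample (B (Suc k), {}, real (card (B (Suc k)))) \<rho>)"
    and L: "L \<in> set_pmf (union_latent L0 L1)"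
    using Suc.prems unfolding \<theta>_def \<rho>_def by (simp add: Let_def) blast
  have \<rho>: "0 < \<rho>" "\<rho> \<le> 1"
    using accept_rate_bounds[OF \<open>n \<ge> 1\<close>] by (auto simp: \<rho>_def)
  have \<theta>: "0 < \<theta>" "\<theta> \<le> 1"
    using \<rho> accept_rate_bounds(1)[OF \<open>n \<ge> 1\<close>] decay_step_bounds(1)[OF assms(1,2)]
      downsample_rate_le_1[OF assms(1-3)] unfolding \<theta>_def \<rho>_def
    by (auto intro!: mult_pos_pos divide_pos_pos simp del: times_divide_eq_left)
  have "valid_latent (\<Union>i\<in>{1..k}. B i) L1"
    using L1 Suc.IH[OF M] valid_latent_downsample[OF _ \<theta>, of _ M L1] by (simp split: if_splits)
  moreover have "valid_latent (B (Suc k)) L0"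
    using valid_latent_downsample[OF valid_latent_full \<rho> L0] fin by simp
  moreover have "B (Suc k) \<inter> (\<Union>i\<in>{1..k}. B i) = {}"
  proof -
    have "B (Suc k) \<inter> B i = {}" if "i \<in> {1..k}" for i
      using disjoint_family_onD[OF disj, of "Suc k" i] that by simp
    then show ?thesis
      by blast
  qed
  ultimately have "valid_latent (B (Suc k) \<union> (\<Union>i\<in>{1..k}. B i)) L"
    using valid_latent_union_latent[OF _ _ _ L] by simp
  then show ?case
    by (simp add: atLeastAtMostSuc_conv)
qed

section \<open>Distribution and variance of the R-TBS sample size\<close>

text \<open>The full items always count and the partial item counts exactly when \<open>u\<close>
  holds. The law of the size thus depends on the latent sample only through its weight.\<close>

lemma map_pmf_card_getsample:
  assumes "valid_latent U L"
  shows "map_pmf (\<lambda>S. real (card S)) (getsample L)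
    = map_pmf (\<lambda>u. of_int \<lfloor>sample_weight L\<rfloor> + of_bool u) (bernoulli_pmf (frac (sample_weight L)))"
proof -
  obtain A \<pi> C where L: "L = (A, \<pi>, C)"
    by (cases L)
  have fin: "finite A" "finite \<pi>" "A \<inter> \<pi> = {}" and cA: "int (card A) = \<lfloor>C\<rfloor>"
    and c\<pi>: "card \<pi> = of_bool (C \<notin> \<int>)"
    using assms by (auto simp: valid_latent_def L)
  have A: "real (card A) = of_int \<lfloor>C\<rfloor>"
    using cA by (metis of_int_of_nat_eq)
  have bern: "unif_le (frac C) = bernoulli_pmf (frac C)"
    using frac_lt_1[of C] by (simp add: unif_le_eq_bernoulli)
  \<comment> \<open>Restricting to the support matters for integer \<open>C\<close>: there
    \<open>\<pi>\<close> is empty, but \<open>u\<close> is never true.\<close>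
  have "real (card (if u then A \<union> \<pi> else A)) = of_int \<lfloor>C\<rfloor> + of_bool u"
    if "u \<in> set_pmf (unif_le (frac C))" for u
    using that fin c\<pi> A by (cases u) (auto simp: set_pmf_unif_le card_Un_disjoint)
  then have "map_pmf (\<lambda>u. real (card (if u then A \<union> \<pi> else A))) (unif_le (frac C))
      = map_pmf (\<lambda>u. of_int \<lfloor>C\<rfloor> + of_bool u) (unif_le (frac C))"
    by (intro map_pmf_cong) auto
  then show ?thesis
    by (simp add: getsample_def L sample_weight_def bern map_pmf_def bind_assoc_pmf
        bind_return_pmf)
qed

lemma variance_shifted_bernoulli:
  assumes "0 \<le> p" "p \<le> 1"
  shows "measure_pmf.variance (map_pmf (\<lambda>u. c + of_bool u) (bernoulli_pmf p)) (\<lambda>x. x)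
    = p * (1 - p)"
  using assms by (simp add: algebra_simps power2_eq_square)

text \<open>The weight is the same for all latent samples in the support, so the conditional law of
  the size is constant and mixing over them adds no variance.\<close>

lemma variance_card_rtbs_sample:
  assumes val: "\<And>L. L \<in> set_pmf (rtbs_latent \<Delta> lam n B k) \<Longrightarrow> valid_latent U L"
    and weight: "\<And>L. L \<in> set_pmf (rtbs_latent \<Delta> lam n B k) \<Longrightarrow> sample_weight L = C"
  shows "measure_pmf.variance (rtbs_sample \<Delta> lam n B k) (\<lambda>S. real (card S))
    = frac C * (1 - frac C)"
proof -
  have "map_pmf (\<lambda>S. real (card S)) (rtbs_sample \<Delta> lam n B k)
      = bind_pmf (rtbs_latent \<Delta> lam n B k) (\<lambda>L. map_pmf (\<lambda>S. real (card S)) (getsample L))"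
    by (simp add: rtbs_sample_def map_bind_pmf)
  also have "\<dots> = bind_pmf (rtbs_latent \<Delta> lam n B k)
      (\<lambda>L. map_pmf (\<lambda>u. of_int \<lfloor>C\<rfloor> + of_bool u) (bernoulli_pmf (frac C)))"
    using map_pmf_card_getsample[OF val] weight by (intro bind_pmf_cong refl) simp
  also have "\<dots> = map_pmf (\<lambda>u. of_int \<lfloor>C\<rfloor> + of_bool u) (bernoulli_pmf (frac C))"
    by simp
  finally have eq: "map_pmf (\<lambda>S. real (card S)) (rtbs_sample \<Delta> lam n B k) = \<dots>" .
  have "measure_pmf.variance (rtbs_sample \<Delta> lam n B k) (\<lambda>S. real (card S))
      = measure_pmf.variance (map_pmf (\<lambda>S. real (card S)) (rtbs_sample \<Delta> lam n B k)) (\<lambda>x. x)"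
    by simp
  also have "\<dots> = frac C * (1 - frac C)"
    unfolding eq by (rule variance_shifted_bernoulli) (auto simp: frac_lt_1 less_imp_le)
  finally show ?thesis .
qed

section \<open>Minimal variance of an integer-valued variable with given mean\<close>

text \<open>Integrability of the square matters: otherwise the Bochner integral defining the
  variance would default to 0.\<close>

lemma (in prob_space) variance_integer_valued_ge:
  fixes X :: "'a \<Rightarrow> int"
  assumes int: "integrable M (\<lambda>\<omega>. real_of_int (X \<omega>))"
    and int2: "integrable M (\<lambda>\<omega>. (real_of_int (X \<omega>))\<^sup>2)"
  defines "C \<equiv> expectation (\<lambda>\<omega>. real_of_int (X \<omega>))"
  shows "variance (\<lambda>\<omega>. real_of_int (X \<omega>)) \<ge> frac C * (1 - frac C)"
proof -
  define f where "f = frac C"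
  \<comment> \<open>The right side is the chord of the parabola \<open>(x - C)\<^sup>2\<close>
    through the integers \<open>\<lfloor>C\<rfloor>\<close> and
    \<open>\<lfloor>C\<rfloor> + 1\<close>. The parabola lies below it only strictly between them,
    where there is no integer.\<close>
  have "(real_of_int (X \<omega>) - C)\<^sup>2 \<ge> (1 - 2 * f) * (real_of_int (X \<omega>) - C) + f * (1 - f)" for \<omega>
  proof -
    define z where "z = X \<omega> - \<lfloor>C\<rfloor>"
    have "z * (z - 1) \<ge> 0"
      by (cases "z \<le> 0") (auto intro: mult_nonneg_nonneg mult_nonpos_nonpos)
    then have "real_of_int (z * (z - 1)) \<ge> 0"
      by (simp only: of_int_0_le_iff)
    moreover have "real_of_int z = real_of_int (X \<omega>) - C + f"
      by (simp add: z_def f_def frac_def)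
    ultimately show ?thesis
      by (simp add: power2_eq_square algebra_simps)
  qed
  moreover have "integrable M (\<lambda>\<omega>. (real_of_int (X \<omega>) - C)\<^sup>2)"
    using int int2 by (simp add: power2_diff)
  ultimately have "expectation (\<lambda>\<omega>. (1 - 2 * f) * (real_of_int (X \<omega>) - C) + f * (1 - f))
      \<le> variance (\<lambda>\<omega>. real_of_int (X \<omega>))"
    unfolding C_def[symmetric] using int by (intro integral_mono) auto
  \<comment> \<open>The linear term is centred at the mean and vanishes.\<close>
  moreover have "expectation (\<lambda>\<omega>. (1 - 2 * f) * (real_of_int (X \<omega>) - C) + f * (1 - f))
      = f * (1 - f)"
    using int by (simp add: C_def prob_space)
  ultimately show ?thesis
    by (simp add: f_def)
qed

section \<open>Comparison of the two variances\<close>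

theorem theorem4p5:
  fixes B :: "nat \<Rightarrow> 'a set" and \<Delta> lam :: real and n :: nat
    and M :: "'w measure" and SH :: "nat \<Rightarrow> 'w \<Rightarrow> 'a set" and k :: nat
  assumes "\<Delta> > 0" and "lam \<ge> 0" and "n \<ge> 1"
    and "\<And>k. k \<ge> 1 \<Longrightarrow> finite (B k)"
    and "disjoint_family_on B {1..}"
    and "prob_space M"
    and "\<And>k. k \<ge> 1 \<Longrightarrow> SH k \<in> measurable M (count_space (Pow (\<Union>i\<in>{1..k}. B i)))"
    and "\<And>k i j x y. \<lbrakk>1 \<le> i; i \<le> j; j \<le> k; x \<in> B i; y \<in> B j\<rbrakk> \<Longrightarrow>
           \<P>(\<omega> in M. x \<in> SH k \<omega>) / \<P>(\<omega> in M. y \<in> SH k \<omega>)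
             = exp_decay lam (age \<Delta> i k) / exp_decay lam (age \<Delta> j k)"
    and "\<And>k L. \<lbrakk>k \<ge> 1; L \<in> set_pmf (rtbs_latent \<Delta> lam n B k)\<rbrakk> \<Longrightarrow>
           prob_space.expectation M (\<lambda>\<omega>. real (card (SH k \<omega>))) = sample_weight L"
    and "k \<ge> 1"
  shows "prob_space.variance M (\<lambda>\<omega>. real (card (SH k \<omega>)))
           \<ge> measure_pmf.variance (rtbs_sample \<Delta> lam n B k) (\<lambda>S. real (card S))"
proof -
  interpret prob_space M by fact
  let ?U = "\<Union>i\<in>{1..k}. B i" and ?X = "\<lambda>\<omega>. int (card (SH k \<omega>))"
  \<comment> \<open>Any possible latent sample serves, since its weight is the deterministic
    \<open>C_k\<close>.\<close>
  obtain L where L: "L \<in> set_pmf (rtbs_latent \<Delta> lam n B k)"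
    using set_pmf_not_empty by (metis all_not_in_conv)
  have "finite ?U"
    using assms(4) by auto
  \<comment> \<open>Only finitely many items have arrived, so the size is bounded; this yields both
    integrability conditions.\<close>
  have bound: "card (SH k \<omega>) \<le> card ?U" if "\<omega> \<in> space M" for \<omega>
    using measurable_space[OF assms(7)[OF \<open>k \<ge> 1\<close>] that] \<open>finite ?U\<close>
    by (intro card_mono) auto
  have meas: "(\<lambda>\<omega>. g (SH k \<omega>)) \<in> borel_measurable M" for g :: "'a set \<Rightarrow> real"
    using assms(7)[OF \<open>k \<ge> 1\<close>] by (rule measurable_compose) simp
  have "integrable M (\<lambda>\<omega>. real_of_int (?X \<omega>))"
    by (rule integrable_const_bound[where B = "card ?U"])
      (use bound meas in \<open>auto intro!: AE_I2\<close>)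
  moreover have "integrable M (\<lambda>\<omega>. (real_of_int (?X \<omega>))\<^sup>2)"
    by (rule integrable_const_bound[where B = "(card ?U)\<^sup>2"])
      (use bound meas in \<open>auto intro!: AE_I2 power_mono\<close>)
  ultimately have "frac (sample_weight L) * (1 - frac (sample_weight L))
      \<le> variance (\<lambda>\<omega>. real (card (SH k \<omega>)))"
    using variance_integer_valued_ge[of ?X] assms(9)[OF \<open>k \<ge> 1\<close> L] by simp
  moreover have "measure_pmf.variance (rtbs_sample \<Delta> lam n B k) (\<lambda>S. real (card S))
      = frac (sample_weight L) * (1 - frac (sample_weight L))"
    using valid_latent_rtbs_latent[OF assms(1-5)] sample_weight_rtbs_latent_unique[OF _ L]
    by (intro variance_card_rtbs_sample) auto
  ultimately show ?thesis
    by simp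
qed

end
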